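(* Let $KB=\langle P,Ab,IC,K\rangle$ be a Horn knowledge base with $IC=\emptyset$, and let $-$ be a contraction operator on $KB^{\bullet}$ satisfying all the AGM postulates $(-1)$ to $(-8)$. Define a contraction function $\dot{-}$ on $KB$ by: for every sentence $\alpha$, $KB\dot{-}\alpha$ is a Horn knowledge base with $(KB\dot{-}\alpha)^{\bullet}=KB^{\bullet}-\alpha$. Then $\dot{-}$ satisfies all the rationality postulates $(\dot{-}1)$ to $(\dot{-}8)$.
   Context: Fix a first-order language $\mathcal{L}$; "sentence" means a sentence of $\mathcal{L}$. A Horn knowledge base is a tuple $KB=\langle P,Ab,IC,K\rangle$ where: $P$ is an acyclic normal logic program (there is a level mapping from ground atoms to $\mathbb{N}$ such that in every ground clause $H\leftarrow L_1,\dots,L_n$ of $P$ the level of $H$ exceeds that of each $L_i$, with $|\neg A|=|A|$), all abducibles at level $0$ and no non-abducible at level $0$; $Ab$ is a set of atoms (abducibles); $IC$ is a set of sentences (integrity constraints); $K$ is a set of sentences whose atoms are all in $Ab$. An abductive interpretation is a set $I\subseteq Ab$. A level-$0$ atom $A$ is true in $I$ iff $A\in I$; an atom $A$ of level $n>0$ is true in $I$ iff some clause $A\leftarrow L_1,\dots,L_k$ of the ground instantiation of $P$ has all positive $L_j$ true in $I$ and, for every negative $L_j=\neg B_j$, $B_j$ false in $I$. Truth extends to sentences classically ($\forall$/$\exists$ via ground instances). $Mod(X)$ is the set of abductive interpretations making the sentence (or all sentences of the set) $X$ true; $Cn_P(X)=\{\alpha: Mod(X)\subseteq Mod(\alpha)\}$;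 $Mod(KB)=Mod(K\cup IC)$; $KB^\bullet=Cn_P(K\cup IC)$; $\alpha$ is accepted in $KB$ iff $\alpha\in KB^\bullet$. $KB_1\equiv KB_2$ iff $P_1=P_2,Ab_1=Ab_2,IC_1=IC_2$ and $Mod(K_1)=Mod(K_2)$. Contraction postulates for $KB\dot{-}\alpha=\langle P',Ab',IC',K'\rangle$: $(\dot{-}1)$ $P'=P,Ab'=Ab,IC'=IC$; $(\dot{-}2)$ if $\alpha$ is not true in all abductive interpretations, then $\alpha$ is not accepted in $KB\dot{-}\alpha$; $(\dot{-}3)$ $Mod(KB)\subseteq Mod(KB\dot{-}\alpha)$; $(\dot{-}4)$ if $\alpha$ is not accepted in $KB$ then $Mod(KB\dot{-}\alpha)=Mod(KB)$; $(\dot{-}5)$ $Mod(KB\dot{-}\alpha)\cap Mod(\alpha)\subseteq Mod(KB)$; $(\dot{-}6)$ if $KB\equiv KB'$ and $Mod(\alpha)=Mod(\beta)$ then $Mod(KB\dot{-}\alpha)=Mod(KB'\dot{-}\beta)$; $(\dot{-}7)$ $Mod(KB\dot{-}(\alpha\land\beta))\subseteq Mod(KB\dot{-}\alpha)\cup Mod(KB\dot{-}\beta)$; $(\dot{-}8)$ if $\alpha$ is not accepted in $KB\dot{-}(\alpha\land\beta)$ then $Mod(KB\dot{-}\alpha)\subseteq Mod(KB\dot{-}(\alpha\land\beta))$. AGM setting (with respect to $Cn_P$): a belief set is a set $T$ of sentences with $T=Cn_P(T)$; $T\#\alpha=Cn_P(T\cup\{\alpha\})$; $\vdash\varphi$ means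 $\varphi\in Cn_P(\emptyset)$. AGM contraction postulates for $T=KB^\bullet$: $(-1)$ $T-\alpha$ is a belief set; $(-2)$ $T-\alpha\subseteq T$; $(-3)$ if $\alpha\notin T$ then $T-\alpha=T$; $(-4)$ if $\nvdash\alpha$ then $\alpha\notin T-\alpha$; $(-5)$ if $\vdash\alpha\leftrightarrow\beta$ then $T-\alpha=T-\beta$; $(-6)$ $T\subseteq(T-\alpha)\#\alpha$; $(-7)$ $(T-\alpha)\cap(T-\beta)\subseteq T-(\alpha\land\beta)$; $(-8)$ if $\alpha\notin T-(\alpha\land\beta)$ then $T-(\alpha\land\beta)\subseteq T-\alpha$.
   Formalization: It is assumed that contraction changes only K, keeping P, Ab and IC (otherwise (∸1) can fail, e.g. by adding a tautology to IC), and that the contraction function is defined by the same recipe on every Horn knowledge base equivalent to KB, as (∸6) needs. *)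

theory Defs
  imports Main
begin

section \<open>Terms, atoms, clauses and formulas of a first-order language\<close>

record ('f, 'p) language =
  Funs :: "('f \<times> nat) set"
  Preds :: "('p \<times> nat) set"

datatype 'f trm = Var nat | Fun 'f "'f trm list"

datatype ('f, 'p) atm = Atm (pred: 'p) (args: "'f trm list")

datatype ('f, 'p) literal = Pos (atom_of: "('f, 'p) atm") | Neg (atom_of: "('f, 'p) atm")

datatype ('f, 'p) clause = Clause (head: "('f, 'p) atm") (body: "('f, 'p) literal list")

datatype ('f, 'p) fm =
    FAtom "('f, 'p) atm"
  | FNot "('f, 'p) fm"
  | FAnd "('f, 'p) fm" "('f, 'p) fm"
  | FOr "('f, 'p) fm" "('f, 'p) fm"
  | FImp "('f, 'p) fm" "('f, 'p) fm"
  | FIff "('f, 'p) fm" "('f, 'p) fm"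
  | FAll nat "('f, 'p) fm"
  | FEx nat "('f, 'p) fm"

fun vars_trm :: "'f trm \<Rightarrow> nat set" where
  "vars_trm (Var x) = {x}"
| "vars_trm (Fun f ts) = (\<Union>t\<in>set ts. vars_trm t)"

primrec subst_trm :: "(nat \<Rightarrow> 'f trm) \<Rightarrow> 'f trm \<Rightarrow> 'f trm" where
  "subst_trm \<sigma> (Var x) = \<sigma> x"
| "subst_trm \<sigma> (Fun f ts) = Fun f (map (subst_trm \<sigma>) ts)"

fun wf_trm :: "('f, 'p) language \<Rightarrow> 'f trm \<Rightarrow> bool" where
  "wf_trm L (Var x) \<longleftrightarrow> True"
| "wf_trm L (Fun f ts) \<longleftrightarrow> (f, length ts) \<in> Funs L \<and> (\<forall>t\<in>set ts. wf_trm L t)"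

definition ground_terms :: "('f, 'p) language \<Rightarrow> 'f trm set" where
  "ground_terms L = {t. wf_trm L t \<and> vars_trm t = {}}"

definition vars_atm :: "('f, 'p) atm \<Rightarrow> nat set" where
  "vars_atm A = (\<Union>t\<in>set (args A). vars_trm t)"

definition subst_atm :: "(nat \<Rightarrow> 'f trm) \<Rightarrow> ('f, 'p) atm \<Rightarrow> ('f, 'p) atm" where
  "subst_atm \<sigma> A = Atm (pred A) (map (subst_trm \<sigma>) (args A))"

definition wf_atm :: "('f, 'p) language \<Rightarrow> ('f, 'p) atm \<Rightarrow> bool" where
  "wf_atm L A \<longleftrightarrow> (pred A, length (args A)) \<in> Preds L \<and> (\<forall>t\<in>set (args A). wf_trm L t)"

definition ground_atoms :: "('f, 'p) language \<Rightarrow> ('f, 'p) atm set" where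
  "ground_atoms L = {A. wf_atm L A \<and> vars_atm A = {}}"

primrec subst_lit :: "(nat \<Rightarrow> 'f trm) \<Rightarrow> ('f, 'p) literal \<Rightarrow> ('f, 'p) literal" where
  "subst_lit \<sigma> (Pos A) = Pos (subst_atm \<sigma> A)"
| "subst_lit \<sigma> (Neg A) = Neg (subst_atm \<sigma> A)"

definition vars_clause :: "('f, 'p) clause \<Rightarrow> nat set" where
  "vars_clause c = vars_atm (head c) \<union> (\<Union>l\<in>set (body c). vars_atm (atom_of l))"

definition subst_clause :: "(nat \<Rightarrow> 'f trm) \<Rightarrow> ('f, 'p) clause \<Rightarrow> ('f, 'p) clause" where
  "subst_clause \<sigma> c = Clause (subst_atm \<sigma> (head c)) (map (subst_lit \<sigma>) (body c))"

definition wf_clause :: "('f, 'p) language \<Rightarrow> ('f, 'p) clause \<Rightarrow> bool" where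
  "wf_clause L c \<longleftrightarrow> wf_atm L (head c) \<and> (\<forall>l\<in>set (body c). wf_atm L (atom_of l))"

text \<open>In the two notions of ground instance below only the variables that occur have to be
  mapped to ground terms, so that variable-free clauses and atoms have themselves as an instance
  even if the language has no ground terms (e.g. a propositional language).\<close>

definition ground_program :: "('f, 'p) language \<Rightarrow> ('f, 'p) clause set \<Rightarrow> ('f, 'p) clause set" where
  "ground_program L P =
     {subst_clause \<sigma> c | \<sigma> c. c \<in> P \<and> (\<forall>x\<in>vars_clause c. \<sigma> x \<in> ground_terms L)}"

definition atm_instances :: "('f, 'p) language \<Rightarrow> ('f, 'p) atm \<Rightarrow> ('f, 'p) atm set" where
  "atm_instances L A = {subst_atm \<sigma> A | \<sigma>. \<forall>x\<in>vars_atm A. \<sigma> x \<in> ground_terms L}"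

primrec wf_fm :: "('f, 'p) language \<Rightarrow> ('f, 'p) fm \<Rightarrow> bool" where
  "wf_fm L (FAtom A) \<longleftrightarrow> wf_atm L A"
| "wf_fm L (FNot p) \<longleftrightarrow> wf_fm L p"
| "wf_fm L (FAnd p q) \<longleftrightarrow> wf_fm L p \<and> wf_fm L q"
| "wf_fm L (FOr p q) \<longleftrightarrow> wf_fm L p \<and> wf_fm L q"
| "wf_fm L (FImp p q) \<longleftrightarrow> wf_fm L p \<and> wf_fm L q"
| "wf_fm L (FIff p q) \<longleftrightarrow> wf_fm L p \<and> wf_fm L q"
| "wf_fm L (FAll x p) \<longleftrightarrow> wf_fm L p"
| "wf_fm L (FEx x p) \<longleftrightarrow> wf_fm L p"

primrec free_vars :: "('f, 'p) fm \<Rightarrow> nat set" where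
  "free_vars (FAtom A) = vars_atm A"
| "free_vars (FNot p) = free_vars p"
| "free_vars (FAnd p q) = free_vars p \<union> free_vars q"
| "free_vars (FOr p q) = free_vars p \<union> free_vars q"
| "free_vars (FImp p q) = free_vars p \<union> free_vars q"
| "free_vars (FIff p q) = free_vars p \<union> free_vars q"
| "free_vars (FAll x p) = free_vars p - {x}"
| "free_vars (FEx x p) = free_vars p - {x}"

primrec atoms_fm :: "('f, 'p) fm \<Rightarrow> ('f, 'p) atm set" where
  "atoms_fm (FAtom A) = {A}"
| "atoms_fm (FNot p) = atoms_fm p"
| "atoms_fm (FAnd p q) = atoms_fm p \<union> atoms_fm q"
| "atoms_fm (FOr p q) = atoms_fm p \<union> atoms_fm q"
| "atoms_fm (FImp p q) = atoms_fm p \<union> atoms_fm q"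
| "atoms_fm (FIff p q) = atoms_fm p \<union> atoms_fm q"
| "atoms_fm (FAll x p) = atoms_fm p"
| "atoms_fm (FEx x p) = atoms_fm p"

definition sentences :: "('f, 'p) language \<Rightarrow> ('f, 'p) fm set" where
  "sentences L = {\<phi>. wf_fm L \<phi> \<and> free_vars \<phi> = {}}"

text \<open>Replacement of the free occurrences of a variable; it is only used with ground terms,
  so capture cannot occur.\<close>

primrec inst :: "nat \<Rightarrow> 'f trm \<Rightarrow> ('f, 'p) fm \<Rightarrow> ('f, 'p) fm" where
  "inst x t (FAtom A) = FAtom (subst_atm (Var(x := t)) A)"
| "inst x t (FNot p) = FNot (inst x t p)"
| "inst x t (FAnd p q) = FAnd (inst x t p) (inst x t q)"
| "inst x t (FOr p q) = FOr (inst x t p) (inst x t q)"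
| "inst x t (FImp p q) = FImp (inst x t p) (inst x t q)"
| "inst x t (FIff p q) = FIff (inst x t p) (inst x t q)"
| "inst x t (FAll y p) = FAll y (if y = x then p else inst x t p)"
| "inst x t (FEx y p) = FEx y (if y = x then p else inst x t p)"

primrec fm_size :: "('f, 'p) fm \<Rightarrow> nat" where
  "fm_size (FAtom A) = 0"
| "fm_size (FNot p) = Suc (fm_size p)"
| "fm_size (FAnd p q) = Suc (fm_size p + fm_size q)"
| "fm_size (FOr p q) = Suc (fm_size p + fm_size q)"
| "fm_size (FImp p q) = Suc (fm_size p + fm_size q)"
| "fm_size (FIff p q) = Suc (fm_size p + fm_size q)"
| "fm_size (FAll x p) = Suc (fm_size p)"
| "fm_size (FEx x p) = Suc (fm_size p)"

lemma fm_size_inst [simp]: "fm_size (inst x t p) = fm_size p"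
  by (induction p) auto


section \<open>Acyclic programs and truth in an abductive interpretation\<close>

definition level_mapping ::
    "('f, 'p) language \<Rightarrow> ('f, 'p) clause set \<Rightarrow> ('f, 'p) atm set \<Rightarrow> (('f, 'p) atm \<Rightarrow> nat) \<Rightarrow> bool" where
  "level_mapping L P Ab lv \<longleftrightarrow>
     (\<forall>c\<in>ground_program L P. \<forall>l\<in>set (body c). lv (atom_of l) < lv (head c)) \<and>
     (\<forall>A\<in>Ab. lv A = 0) \<and>
     (\<forall>A\<in>ground_atoms L - Ab. lv A \<noteq> 0)"

definition level :: "('f, 'p) language \<Rightarrow> ('f, 'p) clause set \<Rightarrow> ('f, 'p) atm set \<Rightarrow> ('f, 'p) atm \<Rightarrow> nat" where
  "level L P Ab = (SOME lv. level_mapping L P Ab lv)"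

text \<open>Truth of ground atoms, by recursion on the level. By lemma \<open>atom_true_iff\<close> below, the
  recursion equations hold for every level mapping, not just for the chosen one.\<close>

definition atom_true ::
    "('f, 'p) language \<Rightarrow> ('f, 'p) clause set \<Rightarrow> ('f, 'p) atm set \<Rightarrow> ('f, 'p) atm set \<Rightarrow> ('f, 'p) atm \<Rightarrow> bool" where
  "atom_true L P Ab I = wfrec (measure (level L P Ab))
     (\<lambda>tr A. if level L P Ab A = 0 then A \<in> I
             else \<exists>c\<in>ground_program L P. head c = A \<and>
                    (\<forall>l\<in>set (body c). case l of Pos B \<Rightarrow> tr B | Neg B \<Rightarrow> \<not> tr B))"

function fm_true :: "'f trm set \<Rightarrow> (('f, 'p) atm \<Rightarrow> bool) \<Rightarrow> ('f, 'p) fm \<Rightarrow> bool" where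
  "fm_true U v (FAtom A) \<longleftrightarrow> v A"
| "fm_true U v (FNot p) \<longleftrightarrow> \<not> fm_true U v p"
| "fm_true U v (FAnd p q) \<longleftrightarrow> fm_true U v p \<and> fm_true U v q"
| "fm_true U v (FOr p q) \<longleftrightarrow> fm_true U v p \<or> fm_true U v q"
| "fm_true U v (FImp p q) \<longleftrightarrow> (fm_true U v p \<longrightarrow> fm_true U v q)"
| "fm_true U v (FIff p q) \<longleftrightarrow> (fm_true U v p \<longleftrightarrow> fm_true U v q)"
| "fm_true U v (FAll x p) \<longleftrightarrow> (\<forall>t\<in>U. fm_true U v (inst x t p))"
| "fm_true U v (FEx x p) \<longleftrightarrow> (\<exists>t\<in>U. fm_true U v (inst x t p))"
  by pat_completeness auto
termination
  by (relation "measure (\<lambda>(U, v, p). fm_size p)") auto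

definition true_in ::
    "('f, 'p) language \<Rightarrow> ('f, 'p) clause set \<Rightarrow> ('f, 'p) atm set \<Rightarrow> ('f, 'p) atm set \<Rightarrow> ('f, 'p) fm \<Rightarrow> bool" where
  "true_in L P Ab I \<phi> \<longleftrightarrow> fm_true (ground_terms L) (atom_true L P Ab I) \<phi>"

definition Mod ::
    "('f, 'p) language \<Rightarrow> ('f, 'p) clause set \<Rightarrow> ('f, 'p) atm set \<Rightarrow> ('f, 'p) fm set \<Rightarrow> ('f, 'p) atm set set" where
  "Mod L P Ab X = {I. I \<subseteq> Ab \<and> (\<forall>\<phi>\<in>X. true_in L P Ab I \<phi>)}"

definition Cn ::
    "('f, 'p) language \<Rightarrow> ('f, 'p) clause set \<Rightarrow> ('f, 'p) atm set \<Rightarrow> ('f, 'p) fm set \<Rightarrow> ('f, 'p) fm set" where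
  "Cn L P Ab X = {\<alpha>\<in>sentences L. Mod L P Ab X \<subseteq> Mod L P Ab {\<alpha>}}"


section \<open>Horn knowledge bases\<close>

record ('f, 'p) kb =
  Prog :: "('f, 'p) clause set"
  Abd :: "('f, 'p) atm set"
  IC :: "('f, 'p) fm set"
  Know :: "('f, 'p) fm set"

definition horn_kb :: "('f, 'p) language \<Rightarrow> ('f, 'p) kb \<Rightarrow> bool" where
  "horn_kb L KB \<longleftrightarrow>
     (\<forall>c\<in>Prog KB. wf_clause L c) \<and>
     Abd KB \<subseteq> ground_atoms L \<and>
     (\<exists>lv. level_mapping L (Prog KB) (Abd KB) lv) \<and>
     IC KB \<subseteq> sentences L \<and>
     Know KB \<subseteq> sentences L \<and>
     (\<forall>\<phi>\<in>Know KB. \<forall>A\<in>atoms_fm \<phi>. atm_instances L A \<subseteq> Abd KB)"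

definition ModKB :: "('f, 'p) language \<Rightarrow> ('f, 'p) kb \<Rightarrow> ('f, 'p) atm set set" where
  "ModKB L KB = Mod L (Prog KB) (Abd KB) (Know KB \<union> IC KB)"

definition ModF :: "('f, 'p) language \<Rightarrow> ('f, 'p) kb \<Rightarrow> ('f, 'p) fm \<Rightarrow> ('f, 'p) atm set set" where
  "ModF L KB \<alpha> = Mod L (Prog KB) (Abd KB) {\<alpha>}"

definition bullet :: "('f, 'p) language \<Rightarrow> ('f, 'p) kb \<Rightarrow> ('f, 'p) fm set" where
  "bullet L KB = Cn L (Prog KB) (Abd KB) (Know KB \<union> IC KB)"

definition accepted :: "('f, 'p) language \<Rightarrow> ('f, 'p) kb \<Rightarrow> ('f, 'p) fm \<Rightarrow> bool" where
  "accepted L KB \<alpha> \<longleftrightarrow> \<alpha> \<in> bullet L KB"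

definition kb_equiv :: "('f, 'p) language \<Rightarrow> ('f, 'p) kb \<Rightarrow> ('f, 'p) kb \<Rightarrow> bool" where
  "kb_equiv L KB1 KB2 \<longleftrightarrow>
     Prog KB1 = Prog KB2 \<and> Abd KB1 = Abd KB2 \<and> IC KB1 = IC KB2 \<and>
     Mod L (Prog KB1) (Abd KB1) (Know KB1) = Mod L (Prog KB2) (Abd KB2) (Know KB2)"

lemma atom_true_iff:
  assumes KB: "horn_kb L KB" and lv: "level_mapping L (Prog KB) (Abd KB) lv"
    and A: "A \<in> ground_atoms L"
  shows "atom_true L (Prog KB) (Abd KB) I A \<longleftrightarrow>
    (if lv A = 0 then A \<in> I
     else \<exists>c\<in>ground_program L (Prog KB). head c = A \<and>
            (\<forall>l\<in>set (body c). case l of Pos B \<Rightarrow> atom_true L (Prog KB) (Abd KB) I B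
                                       | Neg B \<Rightarrow> \<not> atom_true L (Prog KB) (Abd KB) I B))"
proof -
  let ?P = "Prog KB" and ?Ab = "Abd KB"
  let ?lv = "level L ?P ?Ab" and ?tr = "atom_true L ?P ?Ab I"
  have lv': "level_mapping L ?P ?Ab ?lv"
    unfolding level_def using lv by (rule someI [where P = "level_mapping L ?P ?Ab" and x = lv])
  have eq0: "lv A = 0 \<longleftrightarrow> ?lv A = 0"
    using lv lv' A unfolding level_mapping_def by blast
  have cut_eq: "(case l of Pos B \<Rightarrow> cut ?tr (measure ?lv) A B | Neg B \<Rightarrow> \<not> cut ?tr (measure ?lv) A B) \<longleftrightarrow>
      (case l of Pos B \<Rightarrow> ?tr B | Neg B \<Rightarrow> \<not> ?tr B)"
    if "c \<in> ground_program L ?P" "head c = A" "l \<in> set (body c)" for c l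
  proof -
    have "?lv (atom_of l) < ?lv A"
      using lv' that unfolding level_mapping_def by blast
    then show ?thesis
      by (cases l) (auto simp: cut_def)
  qed
  have "?tr A \<longleftrightarrow> (if ?lv A = 0 then A \<in> I
     else \<exists>c\<in>ground_program L ?P. head c = A \<and>
        (\<forall>l\<in>set (body c). case l of Pos B \<Rightarrow> cut ?tr (measure ?lv) A B
                                  | Neg B \<Rightarrow> \<not> cut ?tr (measure ?lv) A B))"
    by (subst (1) def_wfrec [OF atom_true_def [THEN eq_reflection] wf_measure]) (rule refl)
  also have "\<dots> \<longleftrightarrow> (if lv A = 0 then A \<in> I
     else \<exists>c\<in>ground_program L ?P. head c = A \<and>
        (\<forall>l\<in>set (body c). case l of Pos B \<Rightarrow> ?tr B | Neg B \<Rightarrow> \<not> ?tr B))"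
    using cut_eq by (simp add: eq0 cong: conj_cong)
  finally show ?thesis .
qed


section \<open>Postulates for contraction of a knowledge base\<close>

type_synonym ('f, 'p) kb_contraction = "('f, 'p) kb \<Rightarrow> ('f, 'p) fm \<Rightarrow> ('f, 'p) kb"

definition kb_contr1 :: "('f, 'p) language \<Rightarrow> ('f, 'p) kb \<Rightarrow> ('f, 'p) kb_contraction \<Rightarrow> bool" where
  "kb_contr1 L KB con \<longleftrightarrow> (\<forall>\<alpha>\<in>sentences L.
     Prog (con KB \<alpha>) = Prog KB \<and> Abd (con KB \<alpha>) = Abd KB \<and> IC (con KB \<alpha>) = IC KB)"

definition kb_contr2 :: "('f, 'p) language \<Rightarrow> ('f, 'p) kb \<Rightarrow> ('f, 'p) kb_contraction \<Rightarrow> bool" where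
  "kb_contr2 L KB con \<longleftrightarrow> (\<forall>\<alpha>\<in>sentences L.
     \<not> (\<forall>I\<subseteq>Abd KB. true_in L (Prog KB) (Abd KB) I \<alpha>) \<longrightarrow> \<not> accepted L (con KB \<alpha>) \<alpha>)"

definition kb_contr3 :: "('f, 'p) language \<Rightarrow> ('f, 'p) kb \<Rightarrow> ('f, 'p) kb_contraction \<Rightarrow> bool" where
  "kb_contr3 L KB con \<longleftrightarrow> (\<forall>\<alpha>\<in>sentences L. ModKB L KB \<subseteq> ModKB L (con KB \<alpha>))"

definition kb_contr4 :: "('f, 'p) language \<Rightarrow> ('f, 'p) kb \<Rightarrow> ('f, 'p) kb_contraction \<Rightarrow> bool" where
  "kb_contr4 L KB con \<longleftrightarrow> (\<forall>\<alpha>\<in>sentences L.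
     \<not> accepted L KB \<alpha> \<longrightarrow> ModKB L (con KB \<alpha>) = ModKB L KB)"

definition kb_contr5 :: "('f, 'p) language \<Rightarrow> ('f, 'p) kb \<Rightarrow> ('f, 'p) kb_contraction \<Rightarrow> bool" where
  "kb_contr5 L KB con \<longleftrightarrow> (\<forall>\<alpha>\<in>sentences L.
     ModKB L (con KB \<alpha>) \<inter> ModF L KB \<alpha> \<subseteq> ModKB L KB)"

definition kb_contr6 :: "('f, 'p) language \<Rightarrow> ('f, 'p) kb \<Rightarrow> ('f, 'p) kb_contraction \<Rightarrow> bool" where
  "kb_contr6 L KB con \<longleftrightarrow> (\<forall>KB'. \<forall>\<alpha>\<in>sentences L. \<forall>\<beta>\<in>sentences L.
     horn_kb L KB' \<and> kb_equiv L KB KB' \<and> ModF L KB \<alpha> = ModF L KB \<beta> \<longrightarrow>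
     ModKB L (con KB \<alpha>) = ModKB L (con KB' \<beta>))"

definition kb_contr7 :: "('f, 'p) language \<Rightarrow> ('f, 'p) kb \<Rightarrow> ('f, 'p) kb_contraction \<Rightarrow> bool" where
  "kb_contr7 L KB con \<longleftrightarrow> (\<forall>\<alpha>\<in>sentences L. \<forall>\<beta>\<in>sentences L.
     ModKB L (con KB (FAnd \<alpha> \<beta>)) \<subseteq> ModKB L (con KB \<alpha>) \<union> ModKB L (con KB \<beta>))"

definition kb_contr8 :: "('f, 'p) language \<Rightarrow> ('f, 'p) kb \<Rightarrow> ('f, 'p) kb_contraction \<Rightarrow> bool" where
  "kb_contr8 L KB con \<longleftrightarrow> (\<forall>\<alpha>\<in>sentences L. \<forall>\<beta>\<in>sentences L.
     \<not> accepted L (con KB (FAnd \<alpha> \<beta>)) \<alpha> \<longrightarrow>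
     ModKB L (con KB \<alpha>) \<subseteq> ModKB L (con KB (FAnd \<alpha> \<beta>)))"


section \<open>The AGM postulates for contraction of a belief set\<close>

definition belief_set ::
    "('f, 'p) language \<Rightarrow> ('f, 'p) clause set \<Rightarrow> ('f, 'p) atm set \<Rightarrow> ('f, 'p) fm set \<Rightarrow> bool" where
  "belief_set L P Ab T \<longleftrightarrow> T \<subseteq> sentences L \<and> T = Cn L P Ab T"

definition expand ::
    "('f, 'p) language \<Rightarrow> ('f, 'p) clause set \<Rightarrow> ('f, 'p) atm set \<Rightarrow> ('f, 'p) fm set \<Rightarrow> ('f, 'p) fm \<Rightarrow> ('f, 'p) fm set" where
  "expand L P Ab T \<alpha> = Cn L P Ab (T \<union> {\<alpha>})"

definition AGM_contraction ::
    "('f, 'p) language \<Rightarrow> ('f, 'p) clause set \<Rightarrow> ('f, 'p) atm set \<Rightarrow> ('f, 'p) fm set \<Rightarrow>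
     (('f, 'p) fm set \<Rightarrow> ('f, 'p) fm \<Rightarrow> ('f, 'p) fm set) \<Rightarrow> bool" where
  "AGM_contraction L P Ab T con \<longleftrightarrow>
     (\<forall>\<alpha>\<in>sentences L. belief_set L P Ab (con T \<alpha>)) \<and>
     (\<forall>\<alpha>\<in>sentences L. con T \<alpha> \<subseteq> T) \<and>
     (\<forall>\<alpha>\<in>sentences L. \<alpha> \<notin> T \<longrightarrow> con T \<alpha> = T) \<and>
     (\<forall>\<alpha>\<in>sentences L. \<alpha> \<notin> Cn L P Ab {} \<longrightarrow> \<alpha> \<notin> con T \<alpha>) \<and>
     (\<forall>\<alpha>\<in>sentences L. \<forall>\<beta>\<in>sentences L. FIff \<alpha> \<beta> \<in> Cn L P Ab {} \<longrightarrow> con T \<alpha> = con T \<beta>) \<and>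
     (\<forall>\<alpha>\<in>sentences L. T \<subseteq> expand L P Ab (con T \<alpha>) \<alpha>) \<and>
     (\<forall>\<alpha>\<in>sentences L. \<forall>\<beta>\<in>sentences L. con T \<alpha> \<inter> con T \<beta> \<subseteq> con T (FAnd \<alpha> \<beta>)) \<and>
     (\<forall>\<alpha>\<in>sentences L. \<forall>\<beta>\<in>sentences L.
        \<alpha> \<notin> con T (FAnd \<alpha> \<beta>) \<longrightarrow> con T (FAnd \<alpha> \<beta>) \<subseteq> con T \<alpha>)"

end

theory Submission
  imports Defs
begin

text \<open>A set of sentences and its closure under consequence have the same models, so every inclusion
  between closed theories reverses to an inclusion between the model sets of the knowledge bases
  that generate them. Each postulate then translates into its AGM counterpart; only the seventh needs
  an extra idea, namely that an interpretation refuting some member of each of two theories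
  refutes the disjunction of these members, which lies in both theories.\<close>

lemma Mod_antimono: "X \<subseteq> Y \<Longrightarrow> Mod L P Ab Y \<subseteq> Mod L P Ab X"
  by (auto simp: Mod_def)

lemma Mod_Un: "Mod L P Ab (X \<union> Y) = Mod L P Ab X \<inter> Mod L P Ab Y"
  by (auto simp: Mod_def)

text \<open>A sentence in the closure holds in every model of \<open>X\<close> by definition.
  Conversely \<open>X\<close> lies in its closure, but only because its members are sentences:
  \<open>Cn\<close> collects nothing else.\<close>

lemma Mod_Cn:
  assumes "X \<subseteq> sentences L"
  shows "Mod L P Ab (Cn L P Ab X) = Mod L P Ab X"
  using assms by (auto simp: Mod_def Cn_def)

text \<open>The closures matter: a disjunction of a member of \<open>X\<close> and a member of
  \<open>Y\<close> follows from each set but need not belong to either.\<close>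

lemma Mod_Cn_Int_subset:
  assumes "X \<subseteq> sentences L" and "Y \<subseteq> sentences L"
  shows "Mod L P Ab (Cn L P Ab X \<inter> Cn L P Ab Y) \<subseteq> Mod L P Ab X \<union> Mod L P Ab Y"
proof (rule subsetI, rule ccontr)
  fix I
  assume I: "I \<in> Mod L P Ab (Cn L P Ab X \<inter> Cn L P Ab Y)"
    and "I \<notin> Mod L P Ab X \<union> Mod L P Ab Y"
  then obtain \<phi> \<psi> where *: "\<phi> \<in> X" "\<not> true_in L P Ab I \<phi>" "\<psi> \<in> Y" "\<not> true_in L P Ab I \<psi>"
    by (auto simp: Mod_def)
  have "FOr \<phi> \<psi> \<in> sentences L"
    using * assms by (auto simp: sentences_def)
  then have "FOr \<phi> \<psi> \<in> Cn L P Ab X \<inter> Cn L P Ab Y"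
    using * by (auto simp: Cn_def Mod_def true_in_def)
  then have "true_in L P Ab I (FOr \<phi> \<psi>)"
    using I by (simp add: Mod_def)
  then show False
    using * by (simp add: true_in_def)
qed

text \<open>Every subset of \<open>Ab\<close> is a model of the empty set, so a theorem is a
  sentence true in all abductive interpretations. This links the premises of the fifth AGM postulate
  and of \<open>kb_contr6\<close>.\<close>

lemma FIff_in_Cn_empty_iff:
  assumes "\<alpha> \<in> sentences L" and "\<beta> \<in> sentences L"
  shows "FIff \<alpha> \<beta> \<in> Cn L P Ab {} \<longleftrightarrow> Mod L P Ab {\<alpha>} = Mod L P Ab {\<beta>}"
  using assms by (auto simp: Cn_def Mod_def sentences_def true_in_def)

lemma Mod_bullet:
  assumes "horn_kb L X"
  shows "Mod L (Prog X) (Abd X) (bullet L X) = ModKB L X"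
  using assms by (simp add: ModKB_def bullet_def horn_kb_def Mod_Cn)

lemma kb_equiv_refl: "kb_equiv L X X"
  by (simp add: kb_equiv_def)

text \<open>\<open>Cn\<close> depends on its argument only through the models, and those of
  \<open>Know\<close> and \<open>IC\<close> together are an intersection.\<close>

lemma kb_equiv_bullet: "kb_equiv L X Y \<Longrightarrow> bullet L X = bullet L Y"
  by (auto simp: kb_equiv_def bullet_def Cn_def Mod_Un)

theorem theorem9:
  fixes L :: "('f, 'p) language"
    and KB :: "('f, 'p) kb"
    and agm :: "('f, 'p) fm set \<Rightarrow> ('f, 'p) fm \<Rightarrow> ('f, 'p) fm set"
    and con :: "('f, 'p) kb \<Rightarrow> ('f, 'p) fm \<Rightarrow> ('f, 'p) kb"
  assumes "horn_kb L KB"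
    and "IC KB = {}"
    and "AGM_contraction L (Prog KB) (Abd KB) (bullet L KB) agm"
    and "\<And>X \<alpha>. horn_kb L X \<Longrightarrow> kb_equiv L KB X \<Longrightarrow> \<alpha> \<in> sentences L \<Longrightarrow>
           (\<exists>K'. con X \<alpha> = X\<lparr>Know := K'\<rparr>) \<and>
           horn_kb L (con X \<alpha>) \<and>
           bullet L (con X \<alpha>) = agm (bullet L X) \<alpha>"
  shows "kb_contr1 L KB con \<and> kb_contr2 L KB con \<and> kb_contr3 L KB con \<and> kb_contr4 L KB con \<and>
         kb_contr5 L KB con \<and> kb_contr6 L KB con \<and> kb_contr7 L KB con \<and> kb_contr8 L KB con"
proof -
  let ?P = "Prog KB" and ?Ab = "Abd KB" and ?T = "bullet L KB"
  have agm1: "\<forall>\<alpha>\<in>sentences L. belief_set L ?P ?Ab (agm ?T \<alpha>)"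
    and agm2: "\<forall>\<alpha>\<in>sentences L. agm ?T \<alpha> \<subseteq> ?T"
    and agm3: "\<forall>\<alpha>\<in>sentences L. \<alpha> \<notin> ?T \<longrightarrow> agm ?T \<alpha> = ?T"
    and agm4: "\<forall>\<alpha>\<in>sentences L. \<alpha> \<notin> Cn L ?P ?Ab {} \<longrightarrow> \<alpha> \<notin> agm ?T \<alpha>"
    and agm5: "\<forall>\<alpha>\<in>sentences L. \<forall>\<beta>\<in>sentences L.
      FIff \<alpha> \<beta> \<in> Cn L ?P ?Ab {} \<longrightarrow> agm ?T \<alpha> = agm ?T \<beta>"
    and agm6: "\<forall>\<alpha>\<in>sentences L. ?T \<subseteq> expand L ?P ?Ab (agm ?T \<alpha>) \<alpha>"
    and agm7: "\<forall>\<alpha>\<in>sentences L. \<forall>\<beta>\<in>sentences L.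
      agm ?T \<alpha> \<inter> agm ?T \<beta> \<subseteq> agm ?T (FAnd \<alpha> \<beta>)"
    and agm8: "\<forall>\<alpha>\<in>sentences L. \<forall>\<beta>\<in>sentences L.
      \<alpha> \<notin> agm ?T (FAnd \<alpha> \<beta>) \<longrightarrow> agm ?T (FAnd \<alpha> \<beta>) \<subseteq> agm ?T \<alpha>"
    using assms(3) unfolding AGM_contraction_def by - (elim conjE, assumption)+
  \<comment> \<open>The AGM postulates speak of the single belief set \<open>?T\<close>. Equivalent
    knowledge bases share it, so contracting any of them is governed by \<open>agm ?T\<close>;
    \<open>kb_contr6\<close> needs this generality.\<close>
  have sig: "Prog (con X \<alpha>) = ?P \<and> Abd (con X \<alpha>) = ?Ab \<and> IC (con X \<alpha>) = IC KB"
    and horn: "horn_kb L (con X \<alpha>)"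
    and bul: "bullet L (con X \<alpha>) = agm ?T \<alpha>"
    if "horn_kb L X" "kb_equiv L KB X" "\<alpha> \<in> sentences L" for X \<alpha>
    using assms(4)[OF that] that(2) kb_equiv_bullet[OF that(2)] by (auto simp: kb_equiv_def)
  note sig0 = sig[OF assms(1) kb_equiv_refl] and horn0 = horn[OF assms(1) kb_equiv_refl]
    and bul0 = bul[OF assms(1) kb_equiv_refl]
  have mod: "ModKB L (con KB \<alpha>) = Mod L ?P ?Ab (agm ?T \<alpha>)" if "\<alpha> \<in> sentences L" for \<alpha>
    using Mod_bullet[OF horn0[OF that]] sig0[OF that] bul0[OF that] by simp
  have modT: "ModKB L KB = Mod L ?P ?Ab ?T"
    using Mod_bullet[OF assms(1)] by simp
  have closed: "agm ?T \<alpha> \<subseteq> sentences L" "Cn L ?P ?Ab (agm ?T \<alpha>) = agm ?T \<alpha>"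
    if "\<alpha> \<in> sentences L" for \<alpha>
    using agm1 that unfolding belief_set_def by blast+
  have conj: "FAnd \<alpha> \<beta> \<in> sentences L" if "\<alpha> \<in> sentences L" "\<beta> \<in> sentences L" for \<alpha> \<beta>
    using that by (simp add: sentences_def)
  have 1: "kb_contr1 L KB con"
    using sig0 by (simp add: kb_contr1_def)
  have 2: "kb_contr2 L KB con"
    unfolding kb_contr2_def accepted_def
  proof (intro ballI impI)
    fix \<alpha> assume a: "\<alpha> \<in> sentences L"
      and "\<not> (\<forall>I\<subseteq>?Ab. true_in L ?P ?Ab I \<alpha>)"
    \<comment> \<open>An abductive interpretation refuting \<alpha> is a model of the empty
      set.\<close>
    then have "\<alpha> \<notin> Cn L ?P ?Ab {}"
      by (auto simp: Cn_def Mod_def)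
    then show "\<alpha> \<notin> bullet L (con KB \<alpha>)"
      using agm4 a bul0 by simp
  qed
  have 3: "kb_contr3 L KB con"
    using agm2 by (simp add: kb_contr3_def mod modT Mod_antimono)
  have 4: "kb_contr4 L KB con"
    using agm3 by (simp add: kb_contr4_def accepted_def mod modT)
  have 5: "kb_contr5 L KB con"
    unfolding kb_contr5_def
  proof
    fix \<alpha> assume a: "\<alpha> \<in> sentences L"
    have "?T \<subseteq> Cn L ?P ?Ab (agm ?T \<alpha> \<union> {\<alpha>})"
      using agm6 a by (simp add: expand_def)
    then have "Mod L ?P ?Ab (Cn L ?P ?Ab (agm ?T \<alpha> \<union> {\<alpha>})) \<subseteq> Mod L ?P ?Ab ?T"
      by (rule Mod_antimono)
    moreover have "agm ?T \<alpha> \<union> {\<alpha>} \<subseteq> sentences L"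
      using closed(1)[OF a] a by simp
    \<comment> \<open>The intersection on the left is the model set of the union, hence of the
      expansion, whose models satisfy \<open>?T\<close>.\<close>
    ultimately show "ModKB L (con KB \<alpha>) \<inter> ModF L KB \<alpha> \<subseteq> ModKB L KB"
      unfolding mod[OF a] modT ModF_def Mod_Un[symmetric] by (simp add: Mod_Cn)
  qed
  have 6: "kb_contr6 L KB con"
    unfolding kb_contr6_def
  proof (intro allI ballI impI, elim conjE)
    fix X \<alpha> \<beta>
    assume a: "\<alpha> \<in> sentences L" and b: "\<beta> \<in> sentences L" and X: "horn_kb L X" "kb_equiv L KB X"
      and eq: "ModF L KB \<alpha> = ModF L KB \<beta>"
    have "agm ?T \<alpha> = agm ?T \<beta>"
      using agm5 a b eq FIff_in_Cn_empty_iff[OF a b] unfolding ModF_def by blast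
    \<comment> \<open>The contraction of \<open>X\<close> by \<beta> has theory
      \<open>agm ?T \<beta>\<close>, so the \<open>Know\<close> part of \<open>X\<close> no longer
      appears.\<close>
    then have "Mod L ?P ?Ab (bullet L (con X \<beta>)) = Mod L ?P ?Ab (agm ?T \<alpha>)"
      using bul[OF X b] by simp
    then show "ModKB L (con KB \<alpha>) = ModKB L (con X \<beta>)"
      using Mod_bullet[OF horn[OF X b]] sig[OF X b] by (simp add: mod a)
  qed
  have 7: "kb_contr7 L KB con"
    unfolding kb_contr7_def
  proof (intro ballI)
    fix \<alpha> \<beta> assume a: "\<alpha> \<in> sentences L" and b: "\<beta> \<in> sentences L"
    have "Mod L ?P ?Ab (agm ?T (FAnd \<alpha> \<beta>)) \<subseteq> Mod L ?P ?Ab (agm ?T \<alpha> \<inter> agm ?T \<beta>)"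
      using agm7 a b by (intro Mod_antimono) simp
    \<comment> \<open>Both contracted theories are belief sets, hence equal to their
      closures.\<close>
    also have "\<dots> \<subseteq> Mod L ?P ?Ab (agm ?T \<alpha>) \<union> Mod L ?P ?Ab (agm ?T \<beta>)"
      using Mod_Cn_Int_subset[OF closed(1)[OF a] closed(1)[OF b], of ?P ?Ab]
      by (simp only: closed(2)[OF a] closed(2)[OF b])
    finally show "ModKB L (con KB (FAnd \<alpha> \<beta>)) \<subseteq> ModKB L (con KB \<alpha>) \<union> ModKB L (con KB \<beta>)"
      by (simp only: mod a b conj)
  qed
  have 8: "kb_contr8 L KB con"
    \<comment> \<open>By \<open>bul0\<close>, acceptance after contraction is membership in
      \<open>agm ?T (FAnd \<alpha> \<beta>)\<close>, so both postulates have the same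
      premise.\<close>
    using agm8 by (simp add: kb_contr8_def accepted_def bul0 mod conj Mod_antimono)
  show ?thesis
    using 1 2 3 4 5 6 7 8 by blast
qed

end
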